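(* Let $\alpha=(\alpha_1,\dots,\alpha_n)\in\mathbb{R}^n$ with $\alpha_1,\dots,\alpha_n,1$ linearly independent over $\mathbb{Q}$. Then the linear form $L_\alpha$ is badly approximable if and only if there is $\delta>0$ with $|\alpha_{k,1}|\ge\delta$ for all $k\ge1$.
   Context: $L_\alpha(x)=\alpha_1x_1+\cdots+\alpha_nx_n$. For $t\in\mathbb{R}$, $\|t\|$ is the distance from $t$ to the nearest integer. $L_\alpha$ is badly approximable if there is $c>0$ with $\|L_\alpha(q)\|\ge c\|q\|_\infty^{-n}$ for all nonzero $q\in\mathbb{Z}^n$, where $\|\cdot\|_\infty$ is the maximum of absolute values of coordinates. Minkowski chain: let $\ell=n+1$; for $r=(r_1,\dots,r_\ell)\in\mathbb{Z}^\ell$ put $\xi(r)=r_1\alpha_1+\cdots+r_n\alpha_n+r_\ell$. For a real matrix, $\|\cdot\|_\infty$ is the maximum absolute value of its entries. For $m\in\mathbb{Z}^+$, $A_m$ is the nonsingular integral $\ell\times\ell$ matrix with rows $w_1,\dots,w_\ell$ chosen successively: $w_i$ is the vector $w\in\mathbb{Z}^\ell$ with $\|w\|_\infty\le m$, linearly independent of $w_1,\dots,w_{i-1}$, minimizing $|\xi(w)|$, normalized so that its first nonzero entry is positive (unique by the linear independence hypothesis). The Minkowski chain $B_1,B_2,\dots$ is the sequence of distinct matrices among $A_1,A_2,\dots$ in order of appearance. For $B_k$ let $(\beta_1,\dots,\beta_\ell)^\top=B_k(\alpha_1,\dots,\alpha_n,1)^\top$ and define $\alpha_{k,i}=\beta_i/\beta_\ell$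 for $i=1,\dots,n$ (equivalently $(\alpha_{k,1},\dots,\alpha_{k,n})$ is the image of $(\alpha_1,\dots,\alpha_n)$ under $B_k$ acting as a linear fractional map). *)

theory Defs
  imports Complex_Main "HOL-Library.Infinite_Set"
begin

text \<open>Conventions. n is the dimension; alpha :: nat => real with alpha_1..alpha_n stored as
  alpha 0, ..., alpha (n-1). Integer vectors in Z^l (l = n+1) are functions nat => int
  whose coordinates 0..n are used (coordinate n is the last one, r_l).\<close>

definition dist_int :: "real \<Rightarrow> real" where
  "dist_int t = (INF m::int. \<bar>t - of_int m\<bar>)"

definition sup_norm :: "nat \<Rightarrow> (nat \<Rightarrow> int) \<Rightarrow> int" where
  "sup_norm d q = Max ((\<lambda>i. \<bar>q i\<bar>) ` {..<d})"

definition badly_approximable :: "nat \<Rightarrow> (nat \<Rightarrow> real) \<Rightarrow> bool" where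
  "badly_approximable n \<alpha> \<longleftrightarrow>
     (\<exists>c>0. \<forall>q :: nat \<Rightarrow> int. (\<exists>i<n. q i \<noteq> 0) \<longrightarrow>
        dist_int (\<Sum>i<n. of_int (q i) * \<alpha> i) \<ge> c * (of_int (sup_norm n q)) powi (- int n))"

definition lin_indep_with_one :: "nat \<Rightarrow> (nat \<Rightarrow> real) \<Rightarrow> bool" where
  "lin_indep_with_one n \<alpha> \<longleftrightarrow>
     (\<forall>c :: nat \<Rightarrow> rat. (\<Sum>i<n. of_rat (c i) * \<alpha> i) + of_rat (c n) = 0 \<longrightarrow> (\<forall>i\<le>n. c i = 0))"

definition xi :: "nat \<Rightarrow> (nat \<Rightarrow> real) \<Rightarrow> (nat \<Rightarrow> int) \<Rightarrow> real" where
  "xi n \<alpha> r = (\<Sum>i<n. of_int (r i) * \<alpha> i) + of_int (r n)"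

definition lin_indep_vecs :: "nat \<Rightarrow> (nat \<Rightarrow> int) list \<Rightarrow> bool" where
  "lin_indep_vecs n ws \<longleftrightarrow>
     (\<forall>c :: nat \<Rightarrow> rat. (\<forall>j\<le>n. (\<Sum>k<length ws. c k * of_int ((ws ! k) j)) = 0) \<longrightarrow>
        (\<forall>k<length ws. c k = 0))"

definition mink_cand :: "nat \<Rightarrow> nat \<Rightarrow> (nat \<Rightarrow> int) list \<Rightarrow> (nat \<Rightarrow> int) \<Rightarrow> bool" where
  "mink_cand n m ws w \<longleftrightarrow> (\<forall>j>n. w j = 0) \<and> (\<forall>j\<le>n. \<bar>w j\<bar> \<le> int m) \<and> lin_indep_vecs n (ws @ [w])"

definition first_nz_pos :: "nat \<Rightarrow> (nat \<Rightarrow> int) \<Rightarrow> bool" where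
  "first_nz_pos n w \<longleftrightarrow> (\<exists>j\<le>n. w j > 0 \<and> (\<forall>j'<j. w j' = 0))"

definition mink_next :: "nat \<Rightarrow> (nat \<Rightarrow> real) \<Rightarrow> nat \<Rightarrow> (nat \<Rightarrow> int) list \<Rightarrow> (nat \<Rightarrow> int)" where
  "mink_next n \<alpha> m ws = (THE w. mink_cand n m ws w \<and> first_nz_pos n w \<and>
       (\<forall>w'. mink_cand n m ws w' \<longrightarrow> \<bar>xi n \<alpha> w\<bar> \<le> \<bar>xi n \<alpha> w'\<bar>))"

primrec mink_rows :: "nat \<Rightarrow> (nat \<Rightarrow> real) \<Rightarrow> nat \<Rightarrow> nat \<Rightarrow> (nat \<Rightarrow> int) list" where
  "mink_rows n \<alpha> m 0 = []"
| "mink_rows n \<alpha> m (Suc i) = mink_rows n \<alpha> m i @ [mink_next n \<alpha> m (mink_rows n \<alpha> m i)]"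

text \<open>A_m as the list of its l = n+1 rows; entry (i,j) (0-based) is (A ! i) j.\<close>
definition mink_A :: "nat \<Rightarrow> (nat \<Rightarrow> real) \<Rightarrow> nat \<Rightarrow> (nat \<Rightarrow> int) list" where
  "mink_A n \<alpha> m = mink_rows n \<alpha> m (Suc n)"

definition mink_new_indices :: "nat \<Rightarrow> (nat \<Rightarrow> real) \<Rightarrow> nat set" where
  "mink_new_indices n \<alpha> = {m. m \<ge> 1 \<and> (\<forall>j. 1 \<le> j \<and> j < m \<longrightarrow> mink_A n \<alpha> j \<noteq> mink_A n \<alpha> m)}"

definition mink_chain :: "nat \<Rightarrow> (nat \<Rightarrow> real) \<Rightarrow> nat \<Rightarrow> (nat \<Rightarrow> int) list" where
  "mink_chain n \<alpha> k = mink_A n \<alpha> (enumerate (mink_new_indices n \<alpha>) (k - 1))"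

text \<open>beta = B (alpha_1, ..., alpha_n, 1)^T, beta_i for 0-based row i.\<close>
definition chain_beta :: "nat \<Rightarrow> (nat \<Rightarrow> real) \<Rightarrow> nat \<Rightarrow> nat \<Rightarrow> real" where
  "chain_beta n \<alpha> k i = xi n \<alpha> (mink_chain n \<alpha> k ! i)"

text \<open>alpha_{k,i} = beta_i / beta_l for i = 1..n (here with 1-based i).\<close>
definition chain_alpha :: "nat \<Rightarrow> (nat \<Rightarrow> real) \<Rightarrow> nat \<Rightarrow> nat \<Rightarrow> real" where
  "chain_alpha n \<alpha> k i = chain_beta n \<alpha> k (i - 1) / chain_beta n \<alpha> k n"

end

theory Submission
  imports Defs "Jordan_Normal_Form.Determinant"
begin

text \<open>Let \<open>\<beta>\<^sub>1, \<dots>, \<beta>\<^sub>l\<close> be the values of the linear form at the rows of \<open>A\<^sub>m\<close>, so that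
  \<open>\<bar>\<beta>\<^sub>1\<bar> \<le> \<dots> \<le> \<bar>\<beta>\<^sub>l\<bar>\<close>. Bad approximability says that \<open>m\<^sup>n \<bar>\<beta>\<^sub>1\<bar>\<close> is bounded below. Because the determinant
  of \<open>A\<^sub>m\<close> is a nonzero integer, \<open>m\<^sup>n \<bar>\<beta>\<^sub>l\<bar>\<close> is always bounded below, so a lower bound for \<open>\<bar>\<beta>\<^sub>1 / \<beta>\<^sub>l\<bar>\<close> gives
  bad approximability. Conversely, if the form is badly approximable, then \<open>m\<^sup>n \<bar>\<beta>\<^sub>l\<bar>\<close> is also bounded
  above: a rational hyperplane cannot contain all integer vectors with entries of order \<open>m\<close> and
  \<open>\<bar>xi\<bar>\<close> of order \<open>m\<^sup>-\<^sup>n\<close>, since bad approximability keeps these vectors apart and a hyperplane has room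
  for fewer of them than the pigeonhole principle produces.\<close>

section \<open>Linear algebra of integer row vectors\<close>

definition rat_span :: "nat \<Rightarrow> (nat \<Rightarrow> int) list \<Rightarrow> (nat \<Rightarrow> int) \<Rightarrow> bool" where
  "rat_span n ws w \<longleftrightarrow>
     (\<exists>c :: nat \<Rightarrow> rat. \<forall>j\<le>n. of_int (w j) = (\<Sum>k<length ws. c k * of_int ((ws ! k) j)))"

lemma rat_span_append:
  assumes "rat_span n ws w"
  shows "rat_span n (ws @ vs) w"
proof -
  obtain c :: "nat \<Rightarrow> rat" where
    c: "\<forall>j\<le>n. of_int (w j) = (\<Sum>k<length ws. c k * of_int ((ws ! k) j))"
    using assms unfolding rat_span_def by blast
  define d where "d k = (if k < length ws then c k else 0)" for k
  have "(\<Sum>k<length (ws @ vs). d k * of_int (((ws @ vs) ! k) j))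
      = (\<Sum>k<length ws. c k * of_int ((ws ! k) j))" for j
    by (rule sum.mono_neutral_cong_right) (auto simp: d_def nth_append)
  then show ?thesis
    unfolding rat_span_def using c by (intro exI[of _ d]) (simp only:)
qed

lemma lin_indep_vecs_Nil [simp]: "lin_indep_vecs n []"
  by (simp add: lin_indep_vecs_def)

text \<open>A relation with nonzero last coefficient can be solved for \<open>w\<close>, and a
  representation of \<open>w\<close> is a relation with last coefficient -1. This splits the
  candidate condition of the chain into a fact about the earlier rows and one about the new
  row.\<close>

lemma lin_indep_vecs_snoc:
  "lin_indep_vecs n (ws @ [w]) \<longleftrightarrow> lin_indep_vecs n ws \<and> \<not> rat_span n ws w"
proof -
  let ?l = "length ws"
  have sum_snoc: "(\<Sum>k<length (ws @ [w]). c k * of_int (((ws @ [w]) ! k) j))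
      = (\<Sum>k<?l. c k * of_int ((ws ! k) j)) + c ?l * of_int (w j)" for c :: "nat \<Rightarrow> rat" and j
    by (simp add: nth_append)
  show ?thesis
  proof (intro iffI conjI notI)
    assume L: "lin_indep_vecs n (ws @ [w])"
    show "lin_indep_vecs n ws"
      unfolding lin_indep_vecs_def
    proof (intro allI impI)
      fix c :: "nat \<Rightarrow> rat" and k
      assume z: "\<forall>j\<le>n. (\<Sum>k<?l. c k * of_int ((ws ! k) j)) = 0" and k: "k < ?l"
      have "\<forall>j\<le>n. (\<Sum>k<length (ws @ [w]). (c(?l := 0)) k * of_int (((ws @ [w]) ! k) j)) = 0"
        unfolding sum_snoc using z by simp
      then have all: "\<forall>k<length (ws @ [w]). (c(?l := 0)) k = 0"
        using L unfolding lin_indep_vecs_def by (elim allE[of _ "c(?l := 0)"]) (rule mp)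
      show "c k = 0" using all[rule_format, of k] k by simp
    qed
    assume "rat_span n ws w"
    then obtain c :: "nat \<Rightarrow> rat" where
      c: "\<forall>j\<le>n. of_int (w j) = (\<Sum>k<?l. c k * of_int ((ws ! k) j))"
      unfolding rat_span_def by blast
    have "\<forall>j\<le>n. (\<Sum>k<length (ws @ [w]). (c(?l := -1)) k * of_int (((ws @ [w]) ! k) j)) = 0"
      unfolding sum_snoc using c by simp
    then have all: "\<forall>k<length (ws @ [w]). (c(?l := -1)) k = 0"
      using L unfolding lin_indep_vecs_def by (elim allE[of _ "c(?l := -1)"]) (rule mp)
    show False using all[rule_format, of ?l] by simp
  next
    assume R: "lin_indep_vecs n ws \<and> \<not> rat_span n ws w"
    show "lin_indep_vecs n (ws @ [w])"
      unfolding lin_indep_vecs_def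
    proof (rule allI, rule impI)
      fix c :: "nat \<Rightarrow> rat"
      assume "\<forall>j\<le>n. (\<Sum>k<length (ws @ [w]). c k * of_int (((ws @ [w]) ! k) j)) = 0"
      then have z: "(\<Sum>k<?l. c k * of_int ((ws ! k) j)) + c ?l * of_int (w j) = 0" if "j \<le> n" for j
        unfolding sum_snoc using that by blast
      have l: "c ?l = 0"
      proof (rule ccontr)
        assume nz: "c ?l \<noteq> 0"
        have "of_int (w j) = (\<Sum>k<?l. (- c k / c ?l) * of_int ((ws ! k) j))" if "j \<le> n" for j
        proof -
          have "(\<Sum>k<?l. (- c k / c ?l) * of_int ((ws ! k) j))
              = - (\<Sum>k<?l. c k * of_int ((ws ! k) j)) / c ?l"
            by (simp add: sum_divide_distrib sum_negf)
          also have "\<dots> = of_int (w j)"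
            using eq_neg_iff_add_eq_0[THEN iffD2, OF z[OF that]] nz by simp
          finally show ?thesis by simp
        qed
        then have "rat_span n ws w"
          unfolding rat_span_def by (intro exI[of _ "\<lambda>k. - c k / c ?l"]) simp
        then show False using R by blast
      qed
      then have "\<forall>k<?l. c k = 0"
        using R z unfolding lin_indep_vecs_def by simp
      then show "\<forall>k<length (ws @ [w]). c k = 0"
        using l by (simp add: less_Suc_eq)
    qed
  qed
qed

text \<open>At most \<open>n\<close> vectors, padded with zero rows, form a singular square matrix,
  and any kernel vector is orthogonal to all of them. So their span lies in a real
  hyperplane.\<close>

lemma exists_orthogonal_to_span:
  assumes "length ws \<le> n"
  obtains v :: "nat \<Rightarrow> real" where "\<exists>i\<le>n. v i \<noteq> 0"
    and "\<And>w. rat_span n ws w \<Longrightarrow> (\<Sum>i\<le>n. v i * of_int (w i)) = 0"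
proof -
  define A :: "real mat" where
    "A = mat (Suc n) (Suc n) (\<lambda>(i, j). if i < length ws then of_int ((ws ! i) j) else 0)"
  have A: "A \<in> carrier_mat (Suc n) (Suc n)" by (simp add: A_def)
  \<comment> \<open>Row \<open>n\<close> is padding because \<open>length ws \<le> n\<close>, so
    every Leibniz term has a zero factor.\<close>
  have "(\<Prod>i = 0..<Suc n. A $$ (i, p i)) = 0" if "p permutes {0..<Suc n}" for p
  proof (rule prod_zero)
    have "p n < Suc n"
      using permutes_in_image[OF that, of n] by simp
    then have "A $$ (n, p n) = 0"
      using assms by (simp add: A_def)
    then show "\<exists>i\<in>{0..<Suc n}. A $$ (i, p i) = 0" by auto
  qed simp
  then have "det A = 0"
    unfolding det_def'[OF A] by (intro sum.neutral) auto
  then obtain x where x: "x \<in> carrier_vec (Suc n)" "x \<noteq> 0\<^sub>v (Suc n)" "A *\<^sub>v x = 0\<^sub>v (Suc n)"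
    using det_0_iff_vec_prod_zero[OF A] by blast
  show ?thesis
  proof (rule that[of "\<lambda>i. x $ i"])
    show "\<exists>i\<le>n. x $ i \<noteq> 0"
    proof (rule ccontr)
      assume "\<not> ?thesis"
      then have "x = 0\<^sub>v (Suc n)"
        using x(1) by (intro eq_vecI) auto
      then show False using x(2) by blast
    qed
  next
    fix w assume "rat_span n ws w"
    then obtain c :: "nat \<Rightarrow> rat" where
      c: "\<And>j. j \<le> n \<Longrightarrow> of_int (w j) = (\<Sum>k<length ws. c k * of_int ((ws ! k) j))"
      unfolding rat_span_def by blast
    have row: "(\<Sum>j\<le>n. of_int ((ws ! k) j) * x $ j) = 0" if "k < length ws" for k
    proof -
      have "(A *\<^sub>v x) $ k = (\<Sum>j\<le>n. of_int ((ws ! k) j) * x $ j)"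
        using that assms x(1)
        by (auto simp: A_def scalar_prod_def lessThan_Suc_atMost atLeast0LessThan intro!: sum.cong)
      then show ?thesis using x(3) that assms by simp
    qed
    \<comment> \<open>The coefficients \<open>c\<close> are rational; \<open>of_rat\<close> carries
      the relation to the reals, where \<open>x\<close> lives.\<close>
    have wj: "of_int (w j) = (\<Sum>k<length ws. of_rat (c k) * of_int ((ws ! k) j) :: real)"
      if "j \<le> n" for j
    proof -
      have "of_int (w j) = (of_rat (of_int (w j)) :: real)" by simp
      then show ?thesis unfolding c[OF that] by (simp add: of_rat_sum of_rat_mult)
    qed
    have "(\<Sum>i\<le>n. x $ i * of_int (w i))
        = (\<Sum>i\<le>n. \<Sum>k<length ws. of_rat (c k) * (of_int ((ws ! k) i) * x $ i))"
      by (rule sum.cong) (simp_all add: wj sum_distrib_left mult_ac)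
    also have "\<dots> = (\<Sum>k<length ws. of_rat (c k) * (\<Sum>i\<le>n. of_int ((ws ! k) i) * x $ i))"
      by (subst sum.swap) (simp add: sum_distrib_left)
    also have "\<dots> = 0" using row by simp
    finally show "(\<Sum>i\<le>n. x $ i * of_int (w i)) = 0" .
  qed
qed

text \<open>If the integer matrix were singular, its transpose would have a rational kernel vector,
  that is, a rational relation between the rows. Independence thus makes the determinant a nonzero
  integer.\<close>

lemma det_ge_1_of_lin_indep_vecs:
  assumes "length ws = Suc n" "lin_indep_vecs n ws"
  shows "\<bar>det (mat (Suc n) (Suc n) (\<lambda>(i, j). of_int ((ws ! i) j) :: real))\<bar> \<ge> 1"
proof -
  define B :: "int mat" where "B = mat (Suc n) (Suc n) (\<lambda>(i, j). (ws ! i) j)"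
  have B: "B \<in> carrier_mat (Suc n) (Suc n)" by (simp add: B_def)
  interpret rat: comm_ring_hom "of_int :: int \<Rightarrow> rat" by unfold_locales auto
  interpret real: comm_ring_hom "of_int :: int \<Rightarrow> real" by unfold_locales auto
  define C :: "rat mat" where "C = (map_mat of_int B)\<^sup>T"
  have C: "C \<in> carrier_mat (Suc n) (Suc n)" using B by (simp add: C_def)
  have "det B \<noteq> 0"
  proof
    assume "det B = 0"
    then have "det C = 0"
      unfolding C_def using B by (subst det_transpose[of _ "Suc n"]) auto
    then obtain x where x: "x \<in> carrier_vec (Suc n)" "x \<noteq> 0\<^sub>v (Suc n)" "C *\<^sub>v x = 0\<^sub>v (Suc n)"
      using det_0_iff_vec_prod_zero[OF C] by blast
    have "(\<Sum>k<length ws. x $ k * of_int ((ws ! k) j)) = 0" if "j \<le> n" for j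
    proof -
      have "(C *\<^sub>v x) $ j = (\<Sum>k<length ws. x $ k * of_int ((ws ! k) j))"
        using that assms x(1)
        by (auto simp: C_def B_def scalar_prod_def atLeast0LessThan mult_ac intro!: sum.cong)
      then show ?thesis using x(3) that by simp
    qed
    then have "\<forall>k<length ws. x $ k = 0"
      using assms(2) unfolding lin_indep_vecs_def by blast
    then have "x = 0\<^sub>v (Suc n)"
      using x(1) assms(1) by (intro eq_vecI) auto
    then show False using x(2) by blast
  qed
  then have "\<bar>det B\<bar> \<ge> 1" by simp
  moreover have "mat (Suc n) (Suc n) (\<lambda>(i, j). of_int ((ws ! i) j) :: real) = map_mat of_int B"
    by (rule eq_matI) (auto simp: B_def)
  ultimately show ?thesis by simp
qed

lemma rat_span_zero [simp]: "rat_span n ws (\<lambda>j. 0)"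
  unfolding rat_span_def by (rule exI[of _ "\<lambda>k. 0"]) simp

lemma rat_span_cong:
  assumes "\<And>j. j \<le> n \<Longrightarrow> w j = w' j"
  shows "rat_span n ws w \<longleftrightarrow> rat_span n ws w'"
  using assms by (simp add: rat_span_def)

lemma rat_span_uminus:
  assumes "rat_span n ws w"
  shows "rat_span n ws (\<lambda>j. - w j)"
proof -
  obtain c :: "nat \<Rightarrow> rat" where
    c: "\<forall>j\<le>n. of_int (w j) = (\<Sum>k<length ws. c k * of_int ((ws ! k) j))"
    using assms unfolding rat_span_def by blast
  show ?thesis
    unfolding rat_span_def using c by (intro exI[of _ "\<lambda>k. - c k"]) (simp add: sum_negf)
qed

text \<open>Unit vectors have norm 1, so this supplies a candidate for the next row for every
  \<open>m \<ge> 1\<close>. The index \<open>j\<close> is one where a vector orthogonal to the span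
  does not vanish.\<close>

lemma exists_unit_vector_notin_span:
  assumes "length ws \<le> n"
  obtains j where "j \<le> n" "\<not> rat_span n ws (\<lambda>i. if i = j then 1 else 0)"
proof -
  obtain v :: "nat \<Rightarrow> real" where v: "\<exists>i\<le>n. v i \<noteq> 0"
    and o: "\<And>w. rat_span n ws w \<Longrightarrow> (\<Sum>i\<le>n. v i * of_int (w i)) = 0"
    using exists_orthogonal_to_span[OF assms] by blast
  obtain j where j: "j \<le> n" "v j \<noteq> 0" using v by blast
  have "(\<Sum>i\<le>n. v i * of_int (if i = j then 1 else 0)) = (\<Sum>i\<le>n. if i = j then v i else 0)"
    by (rule sum.cong) auto
  also have "\<dots> = v j" using j by simp
  finally show ?thesis using that[of j] o[of "\<lambda>i. if i = j then 1 else 0"] j by auto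
qed

section \<open>The rows of the Minkowski chain\<close>

lemma xi_uminus: "xi n \<alpha> (\<lambda>j. - w j) = - xi n \<alpha> w"
  by (simp add: xi_def sum_negf)

lemma xi_diff: "xi n \<alpha> (\<lambda>j. w j - w' j) = xi n \<alpha> w - xi n \<alpha> w'"
  by (simp add: xi_def sum_subtractf algebra_simps)

lemma xi_eq_0_iff:
  assumes "lin_indep_with_one n \<alpha>"
  shows "xi n \<alpha> w = 0 \<longleftrightarrow> (\<forall>j\<le>n. w j = 0)"
proof
  assume "xi n \<alpha> w = 0"
  then have "(\<Sum>i<n. of_rat (of_int (w i)) * \<alpha> i) + of_rat (of_int (w n)) = 0"
    by (simp add: xi_def)
  then have "\<forall>i\<le>n. (of_int (w i) :: rat) = 0"
    using assms[unfolded lin_indep_with_one_def, rule_format, of "\<lambda>i. of_int (w i)"] by blast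
  then show "\<forall>j\<le>n. w j = 0" by simp
qed (simp add: xi_def)

lemma xi_eq_iff:
  assumes "lin_indep_with_one n \<alpha>"
  shows "xi n \<alpha> w = xi n \<alpha> w' \<longleftrightarrow> (\<forall>j\<le>n. w j = w' j)"
  using xi_eq_0_iff[OF assms, of "\<lambda>j. w j - w' j"] by (simp add: xi_diff)

lemma xi_bound:
  assumes "\<And>j. j \<le> n \<Longrightarrow> \<bar>real_of_int (w j)\<bar> \<le> B"
  shows "\<bar>xi n \<alpha> w\<bar> \<le> B * ((\<Sum>i<n. \<bar>\<alpha> i\<bar>) + 1)"
proof -
  have "\<bar>xi n \<alpha> w\<bar> \<le> \<bar>\<Sum>i<n. of_int (w i) * \<alpha> i\<bar> + \<bar>real_of_int (w n)\<bar>"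
    unfolding xi_def by (rule abs_triangle_ineq)
  also have "\<dots> \<le> (\<Sum>i<n. \<bar>of_int (w i) * \<alpha> i\<bar>) + \<bar>real_of_int (w n)\<bar>"
    by simp
  also have "\<dots> \<le> (\<Sum>i<n. B * \<bar>\<alpha> i\<bar>) + B"
    using assms by (intro add_mono sum_mono) (auto simp: abs_mult intro!: mult_right_mono)
  finally show ?thesis by (simp add: sum_distrib_left algebra_simps)
qed

lemma mink_cand_iff:
  "mink_cand n m ws w \<longleftrightarrow> (\<forall>j>n. w j = 0) \<and> (\<forall>j\<le>n. \<bar>w j\<bar> \<le> int m) \<and>
     lin_indep_vecs n ws \<and> \<not> rat_span n ws w"
  by (auto simp: mink_cand_def lin_indep_vecs_snoc)

lemma mink_cand_uminus:
  assumes "mink_cand n m ws w"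
  shows "mink_cand n m ws (\<lambda>j. - w j)"
  using assms rat_span_uminus[of n ws "\<lambda>j. - w j"] by (auto simp: mink_cand_iff)

lemma finite_mink_cand: "finite {w. mink_cand n m ws w}"
proof (rule finite_subset)
  show "{w. mink_cand n m ws w}
      \<subseteq> {f. \<forall>x. (x \<in> {..n} \<longrightarrow> f x \<in> {- int m..int m}) \<and> (x \<notin> {..n} \<longrightarrow> f x = 0)}"
    by (auto simp: mink_cand_iff abs_le_iff minus_le_iff)
qed (intro finite_set_of_finite_funs; simp)

lemma first_nz_pos_cases:
  assumes "\<exists>j\<le>n. w j \<noteq> 0"
  shows "first_nz_pos n w \<or> first_nz_pos n (\<lambda>j. - w j)"
proof -
  define j where "j = (LEAST j. w j \<noteq> 0)"
  have j: "w j \<noteq> 0" unfolding j_def using assms by (metis (mono_tags) LeastI)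
  have before: "\<forall>j'<j. w j' = 0" unfolding j_def using not_less_Least by blast
  have "j \<le> n" using assms before by (meson le_trans not_le)
  then show ?thesis
    using j before unfolding first_nz_pos_def by (cases "w j > 0") (auto intro!: exI[of _ j])
qed

lemma not_first_nz_pos_uminus:
  assumes "first_nz_pos n w" "\<And>j. j \<le> n \<Longrightarrow> w' j = - w j"
  shows "\<not> first_nz_pos n w'"
proof
  assume "first_nz_pos n w'"
  then obtain j' where j': "j' \<le> n" "w' j' > 0" "\<forall>i<j'. w' i = 0"
    unfolding first_nz_pos_def by blast
  obtain j where j: "j \<le> n" "w j > 0" "\<forall>i<j. w i = 0"
    using assms(1) unfolding first_nz_pos_def by blast
  show False
    using j j' assms(2)[of j] assms(2)[of j'] by (cases j j' rule: linorder_cases) auto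
qed

text \<open>The description in \<open>mink_next\<close> is proper: a unit vector outside the span is
  a candidate, a finite nonempty set has a minimizer, and since \<open>xi\<close> separates integer
  vectors by \<open>indep\<close>, two minimizers agree up to sign, which
  \<open>first_nz_pos\<close> fixes.\<close>

lemma mink_next_minimal:
  assumes indep: "lin_indep_with_one n \<alpha>" and "m \<ge> 1" "length ws \<le> n" "lin_indep_vecs n ws"
  shows "mink_cand n m ws (mink_next n \<alpha> m ws)"
    and "mink_cand n m ws w' \<Longrightarrow> \<bar>xi n \<alpha> (mink_next n \<alpha> m ws)\<bar> \<le> \<bar>xi n \<alpha> w'\<bar>"
proof -
  let ?P = "\<lambda>w. mink_cand n m ws w \<and> first_nz_pos n w \<and>
       (\<forall>w'. mink_cand n m ws w' \<longrightarrow> \<bar>xi n \<alpha> w\<bar> \<le> \<bar>xi n \<alpha> w'\<bar>)"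
  obtain j where "j \<le> n" "\<not> rat_span n ws (\<lambda>i. if i = j then 1 else 0)"
    using exists_unit_vector_notin_span assms(3) by blast
  then have "mink_cand n m ws (\<lambda>i. if i = j then 1 else 0)"
    using assms by (auto simp: mink_cand_iff)
  then obtain u where u: "mink_cand n m ws u"
    and u_min: "\<And>w'. mink_cand n m ws w' \<Longrightarrow> \<bar>xi n \<alpha> u\<bar> \<le> \<bar>xi n \<alpha> w'\<bar>"
    using ex_is_arg_min_if_finite[OF finite_mink_cand, of n m ws "\<lambda>w. \<bar>xi n \<alpha> w\<bar>"]
    by (auto simp: is_arg_min_linorder)
  have "\<exists>j\<le>n. u j \<noteq> 0"
    using u rat_span_cong[of n u "\<lambda>j. 0" ws] by (auto simp: mink_cand_iff)
  then have "first_nz_pos n u \<or> first_nz_pos n (\<lambda>j. - u j)"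
    by (rule first_nz_pos_cases)
  then have ex: "\<exists>w. ?P w"
  proof
    assume "first_nz_pos n u"
    then show ?thesis using u u_min by blast
  next
    assume "first_nz_pos n (\<lambda>j. - u j)"
    then have "?P (\<lambda>j. - u j)"
      using mink_cand_uminus[OF u] u_min by (simp add: xi_uminus)
    then show ?thesis by blast
  qed
  have unique: "w = w'" if "?P w" "?P w'" for w w'
  proof -
    have "\<bar>xi n \<alpha> w\<bar> = \<bar>xi n \<alpha> w'\<bar>" using that by (meson order_antisym)
    then consider "xi n \<alpha> w = xi n \<alpha> w'" | "xi n \<alpha> w' = xi n \<alpha> (\<lambda>j. - w j)"
      unfolding xi_uminus by linarith
    then show ?thesis
    proof cases
      case 1
      then have "\<forall>j\<le>n. w j = w' j" using xi_eq_iff[OF indep] by blast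
      moreover have "\<forall>j>n. w j = w' j" using that by (simp add: mink_cand_iff)
      ultimately show ?thesis by (metis ext not_le)
    next
      case 2
      then have "\<forall>j\<le>n. w' j = - w j" using xi_eq_iff[OF indep, of w' "\<lambda>j. - w j"] by simp
      then show ?thesis using not_first_nz_pos_uminus[of n w w'] that by blast
    qed
  qed
  have "\<exists>!w. ?P w" using ex unique by blast
  then have P: "?P (mink_next n \<alpha> m ws)"
    unfolding mink_next_def by (rule theI')
  show "mink_cand n m ws (mink_next n \<alpha> m ws)" using P by blast
  show "mink_cand n m ws w' \<Longrightarrow> \<bar>xi n \<alpha> (mink_next n \<alpha> m ws)\<bar> \<le> \<bar>xi n \<alpha> w'\<bar>"
    using P by blast
qed

lemma length_mink_rows [simp]: "length (mink_rows n \<alpha> m i) = i"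
  by (induction i) auto

lemma mink_rows_prefix:
  assumes "i \<le> j"
  shows "\<exists>vs. mink_rows n \<alpha> m j = mink_rows n \<alpha> m i @ vs"
  using assms by (induction j rule: dec_induct) auto

lemma lin_indep_mink_rows:
  assumes "lin_indep_with_one n \<alpha>" "m \<ge> 1" "i \<le> Suc n"
  shows "lin_indep_vecs n (mink_rows n \<alpha> m i)"
  using assms(3)
proof (induction i)
  case (Suc i)
  then show ?case
    using mink_next_minimal(1)[OF assms(1,2), of "mink_rows n \<alpha> m i"]
    by (simp add: mink_cand_iff lin_indep_vecs_snoc)
qed simp

lemma mink_A_nth:
  assumes "i \<le> n"
  shows "mink_A n \<alpha> m ! i = mink_next n \<alpha> m (mink_rows n \<alpha> m i)"
proof -
  obtain vs where "mink_A n \<alpha> m = mink_rows n \<alpha> m (Suc i) @ vs"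
    unfolding mink_A_def using mink_rows_prefix[of "Suc i" "Suc n" n \<alpha> m] assms by auto
  then show ?thesis by (simp add: nth_append)
qed

section \<open>Extremal properties of the rows of a single matrix\<close>

locale minkowski_matrix =
  fixes n :: nat and \<alpha> :: "nat \<Rightarrow> real" and m :: nat
  assumes indep: "lin_indep_with_one n \<alpha>" and m_ge_1: "m \<ge> 1"
begin

lemma mink_cand_row:
  assumes "i \<le> n"
  shows "mink_cand n m (mink_rows n \<alpha> m i) (mink_A n \<alpha> m ! i)"
  using mink_next_minimal(1)[OF indep m_ge_1 _ lin_indep_mink_rows] assms indep m_ge_1
  by (simp add: mink_A_nth)

lemma row_bound:
  assumes "i \<le> n" "j \<le> n"
  shows "\<bar>(mink_A n \<alpha> m ! i) j\<bar> \<le> int m"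
  using mink_cand_row[OF assms(1)] assms(2) by (simp add: mink_cand_iff)

lemma xi_row_le:
  assumes "i \<le> n" "\<And>j. j > n \<Longrightarrow> w j = 0" "\<And>j. j \<le> n \<Longrightarrow> \<bar>w j\<bar> \<le> int m"
    and "\<not> rat_span n (mink_rows n \<alpha> m i) w"
  shows "\<bar>xi n \<alpha> (mink_A n \<alpha> m ! i)\<bar> \<le> \<bar>xi n \<alpha> w\<bar>"
proof -
  have L: "lin_indep_vecs n (mink_rows n \<alpha> m i)"
    using lin_indep_mink_rows[OF indep m_ge_1] assms(1) by simp
  then have "mink_cand n m (mink_rows n \<alpha> m i) w"
    using assms by (simp add: mink_cand_iff)
  then show ?thesis
    using mink_next_minimal(2)[OF indep m_ge_1 _ L] assms(1) by (simp add: mink_A_nth)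
qed

lemma xi_first_row_le:
  assumes "\<And>j. j > n \<Longrightarrow> w j = 0" "\<And>j. j \<le> n \<Longrightarrow> \<bar>w j\<bar> \<le> int m" "\<exists>j\<le>n. w j \<noteq> 0"
  shows "\<bar>xi n \<alpha> (mink_A n \<alpha> m ! 0)\<bar> \<le> \<bar>xi n \<alpha> w\<bar>"
  using assms by (intro xi_row_le) (auto simp: rat_span_def)

text \<open>The last row is outside the span of all earlier rows, hence outside the span of the
  first \<open>i\<close> of them, so it competes in the choice of row \<open>i\<close>.\<close>

lemma xi_row_le_last:
  assumes "i \<le> n"
  shows "\<bar>xi n \<alpha> (mink_A n \<alpha> m ! i)\<bar> \<le> \<bar>xi n \<alpha> (mink_A n \<alpha> m ! n)\<bar>"
proof -
  obtain vs where vs: "mink_rows n \<alpha> m n = mink_rows n \<alpha> m i @ vs"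
    using mink_rows_prefix[OF assms] by blast
  have c: "mink_cand n m (mink_rows n \<alpha> m n) (mink_A n \<alpha> m ! n)"
    by (rule mink_cand_row) simp
  then have "\<not> rat_span n (mink_rows n \<alpha> m i) (mink_A n \<alpha> m ! n)"
    using rat_span_append unfolding vs mink_cand_iff by blast
  then show ?thesis
    using c assms by (intro xi_row_le) (auto simp: mink_cand_iff)
qed

lemma row_nonzero:
  assumes "i \<le> n"
  shows "\<exists>j\<le>n. (mink_A n \<alpha> m ! i) j \<noteq> 0"
  using mink_cand_row[OF assms] rat_span_cong[of n "mink_A n \<alpha> m ! i" "\<lambda>j. 0" "mink_rows n \<alpha> m i"]
  by (auto simp: mink_cand_iff)

lemma xi_row_nonzero:
  assumes "i \<le> n"
  shows "xi n \<alpha> (mink_A n \<alpha> m ! i) \<noteq> 0"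
  using row_nonzero[OF assms] xi_eq_0_iff[OF indep] by blast

text \<open>The column operation that replaces the last column of the matrix by the values of the
  linear form does not change the determinant, which is a nonzero integer.\<close>

lemma xi_last_row_ge:
  "1 \<le> fact (Suc n) * real m ^ n * \<bar>xi n \<alpha> (mink_A n \<alpha> m ! n)\<bar>"
proof -
  let ?w = "\<lambda>i. mink_A n \<alpha> m ! i"
  let ?\<beta> = "\<bar>xi n \<alpha> (?w n)\<bar>"
  define A :: "real mat" where "A = mat (Suc n) (Suc n) (\<lambda>(i, j). of_int (?w i j))"
  \<comment> \<open>\<open>U\<close> is unit upper triangular with last column (\<alpha>, 1).
    Multiplying by it on the right keeps the first \<open>n\<close> columns and puts
    \<open>xi\<close> of each row in the last one.\<close>
  define U :: "real mat" where "U = mat (Suc n) (Suc n)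
     (\<lambda>(i, j). if j < n then (if i = j then 1 else 0) else if i < n then \<alpha> i else 1)"
  define R :: "real mat" where "R = mat (Suc n) (Suc n)
     (\<lambda>(i, j). if j < n then of_int (?w i j) else xi n \<alpha> (?w i))"
  have carrier: "A \<in> carrier_mat (Suc n) (Suc n)" "U \<in> carrier_mat (Suc n) (Suc n)"
      "R \<in> carrier_mat (Suc n) (Suc n)"
    by (simp_all add: A_def U_def R_def)
  have "R = A * U"
  proof (rule eq_matI)
    fix i j assume "i < dim_row (A * U)" "j < dim_col (A * U)"
    then have ij: "i < Suc n" "j < Suc n" using carrier by auto
    have prod: "(A * U) $$ (i, j) = (\<Sum>k<n. of_int (?w i k) * U $$ (k, j)) + of_int (?w i n) * U $$ (n, j)"
      using ij by (simp add: A_def U_def scalar_prod_def atLeast0LessThan)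
    show "R $$ (i, j) = (A * U) $$ (i, j)"
    proof (cases "j < n")
      case True
      have "(\<Sum>k<n. of_int (?w i k) * U $$ (k, j)) = (\<Sum>k<n. if k = j then real_of_int (?w i k) else 0)"
        using True by (intro sum.cong) (auto simp: U_def)
      then show ?thesis
        unfolding prod using True ij by (simp add: R_def U_def)
    next
      case False
      then show ?thesis
        unfolding prod using ij by (simp add: R_def U_def xi_def)
    qed
  qed (use carrier in auto)
  moreover have "det U = 1"
  proof -
    have "upper_triangular U" by (auto simp: U_def)
    then have "det U = prod_list (diag_mat U)"
      using carrier(2) by (rule det_upper_triangular)
    also have "\<dots> = 1"
      unfolding prod_list_diag_prod by (rule prod.neutral) (auto simp: U_def)
    finally show ?thesis .
  qed
  ultimately have "det R = det A" using det_mult[OF carrier(1,2)] by simp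
  moreover have "\<bar>det A\<bar> \<ge> 1"
    unfolding A_def mink_A_def
    by (rule det_ge_1_of_lin_indep_vecs) (auto simp del: mink_rows.simps intro: lin_indep_mink_rows indep m_ge_1)
  moreover have "\<bar>det R\<bar> \<le> fact (Suc n) * (real m ^ n * ?\<beta>)"
  proof -
    \<comment> \<open>A bound depending only on the column. Each Leibniz term takes one entry from
      every column, so it is at most the product of these bounds.\<close>
    define b where "b j = (if j < n then real m else ?\<beta>)" for j
    have entry: "\<bar>R $$ (i, j)\<bar> \<le> b j" if "i < Suc n" "j < Suc n" for i j
    proof (cases "j < n")
      case True
      then show ?thesis
        using that row_bound[of i j] by (simp add: R_def b_def)
    next
      case False
      then show ?thesis using that xi_row_le_last[of i] by (simp add: R_def b_def)
    qed
    have "\<bar>signof p * (\<Prod>i = 0..<Suc n. R $$ (i, p i))\<bar> \<le> real m ^ n * ?\<beta>"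
      if p: "p permutes {0..<Suc n}" for p
    proof -
      have "\<bar>signof p * (\<Prod>i = 0..<Suc n. R $$ (i, p i))\<bar> = (\<Prod>i = 0..<Suc n. \<bar>R $$ (i, p i)\<bar>)"
        by (auto simp: abs_mult sign_def abs_prod simp del: prod.op_ivl_Suc)
      also have "\<dots> \<le> (\<Prod>i = 0..<Suc n. b (p i))"
        using permutes_in_image[OF p] by (intro prod_mono) (auto intro!: entry)
      also have "\<dots> = (\<Prod>i = 0..<Suc n. b i)"
        using prod.permute[OF p, of b] by (simp add: comp_def)
      also have "\<dots> = real m ^ n * ?\<beta>" by (simp add: b_def)
      finally show ?thesis .
    qed
    then have "\<bar>det R\<bar> \<le> (\<Sum>p | p permutes {0..<Suc n}. real m ^ n * ?\<beta>)"
      unfolding det_def'[OF carrier(3)] by (intro order.trans[OF sum_abs] sum_mono) auto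
    also have "\<dots> = fact (Suc n) * (real m ^ n * ?\<beta>)"
      using card_permutations[of "{0..<Suc n}" "Suc n"] by (simp del: fact_Suc)
    finally show ?thesis .
  qed
  ultimately show ?thesis by (simp add: mult.assoc)
qed

end

section \<open>Bad approximability bounds the last minimum\<close>

text \<open>The nearest integer becomes the free last coordinate \<open>w n\<close>, which removes
  the infimum, and any upper bound \<open>s\<close> may replace the sup norm because
  \<open>s ^ n\<close> is monotone. In this form the condition applies directly to rows of the
  matrices.\<close>

lemma badly_approximable_iff:
  "badly_approximable n \<alpha> \<longleftrightarrow>
     (\<exists>c>0. \<forall>w s. (\<exists>i<n. w i \<noteq> 0) \<longrightarrow> (\<forall>i<n. \<bar>real_of_int (w i)\<bar> \<le> s) \<longrightarrow>
        c \<le> s ^ n * \<bar>xi n \<alpha> w\<bar>)"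
proof -
  have norm: "real_of_int (sup_norm n w) \<ge> 1" "\<And>i. i < n \<Longrightarrow> \<bar>w i\<bar> \<le> sup_norm n w"
    if "\<exists>i<n. w i \<noteq> 0" for w
  proof -
    show *: "\<And>i. i < n \<Longrightarrow> \<bar>w i\<bar> \<le> sup_norm n w"
      unfolding sup_norm_def by (intro Max_ge) auto
    from that obtain i where "i < n" "w i \<noteq> 0" by blast
    then have "sup_norm n w \<ge> 1" using *[of i] by linarith
    then show "real_of_int (sup_norm n w) \<ge> 1" by simp
  qed
  have powi: "c * x powi (- int n) \<le> y \<longleftrightarrow> c \<le> x ^ n * y" if "x \<ge> 1" for c x y :: real
    using that by (simp add: power_int_minus field_simps)
  show ?thesis
  proof
    assume "badly_approximable n \<alpha>"
    then obtain c where c: "c > 0" and bad: "\<And>q. \<exists>i<n. q i \<noteq> 0 \<Longrightarrow>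
        c * of_int (sup_norm n q) powi (- int n) \<le> dist_int (\<Sum>i<n. of_int (q i) * \<alpha> i)"
      unfolding badly_approximable_def by auto
    have "c \<le> s ^ n * \<bar>xi n \<alpha> w\<bar>"
      if nz: "\<exists>i<n. w i \<noteq> 0" and s: "\<forall>i<n. \<bar>real_of_int (w i)\<bar> \<le> s" for w s
    proof -
      have "dist_int (\<Sum>i<n. of_int (w i) * \<alpha> i) \<le> \<bar>xi n \<alpha> w\<bar>"
      proof -
        have "dist_int (\<Sum>i<n. of_int (w i) * \<alpha> i) \<le> \<bar>(\<Sum>i<n. of_int (w i) * \<alpha> i) - of_int (- w n)\<bar>"
          unfolding dist_int_def by (rule cINF_lower) (auto intro!: bdd_belowI[of _ 0])
        then show ?thesis by (simp add: xi_def)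
      qed
      then have "c \<le> of_int (sup_norm n w) ^ n * \<bar>xi n \<alpha> w\<bar>"
        using bad[OF nz] powi[OF norm(1)[OF nz]] by (meson order.trans)
      also have "\<dots> \<le> s ^ n * \<bar>xi n \<alpha> w\<bar>"
      proof (intro mult_right_mono power_mono)
        have "sup_norm n w \<in> (\<lambda>i. \<bar>w i\<bar>) ` {..<n}"
          unfolding sup_norm_def using nz by (intro Max_in) auto
        then show "real_of_int (sup_norm n w) \<le> s" using s by auto
      qed (use norm(1)[OF nz] in auto)
      finally show ?thesis .
    qed
    then show "\<exists>c>0. \<forall>w s. (\<exists>i<n. w i \<noteq> 0) \<longrightarrow> (\<forall>i<n. \<bar>real_of_int (w i)\<bar> \<le> s) \<longrightarrow>
        c \<le> s ^ n * \<bar>xi n \<alpha> w\<bar>"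
      using c by blast
  next
    assume "\<exists>c>0. \<forall>w s. (\<exists>i<n. w i \<noteq> 0) \<longrightarrow> (\<forall>i<n. \<bar>real_of_int (w i)\<bar> \<le> s) \<longrightarrow>
        c \<le> s ^ n * \<bar>xi n \<alpha> w\<bar>"
    then obtain c where c: "c > 0" and bad: "\<And>w s. \<exists>i<n. w i \<noteq> 0 \<Longrightarrow>
        \<forall>i<n. \<bar>real_of_int (w i)\<bar> \<le> s \<Longrightarrow> c \<le> s ^ n * \<bar>xi n \<alpha> w\<bar>"
      by blast
    have "c * of_int (sup_norm n q) powi (- int n) \<le> dist_int (\<Sum>i<n. of_int (q i) * \<alpha> i)"
      if nz: "\<exists>i<n. q i \<noteq> 0" for q
      unfolding dist_int_def
    proof (rule cINF_greatest)
      fix p :: int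
      \<comment> \<open>Each integer \<open>p\<close> in the infimum corresponds to the vector with
        last coordinate \<open>- p\<close>.\<close>
      have xi: "xi n \<alpha> (q(n := - p)) = (\<Sum>i<n. of_int (q i) * \<alpha> i) - of_int p"
        by (simp add: xi_def)
      have "c \<le> of_int (sup_norm n q) ^ n * \<bar>xi n \<alpha> (q(n := - p))\<bar>"
      proof (rule bad)
        show "\<exists>i<n. (q(n := - p)) i \<noteq> 0" using nz by auto
        show "\<forall>i<n. \<bar>real_of_int ((q(n := - p)) i)\<bar> \<le> of_int (sup_norm n q)"
          using norm(2)[OF nz] by (metis fun_upd_apply less_irrefl of_int_abs of_int_le_iff)
      qed
      then show "c * of_int (sup_norm n q) powi (- int n)
          \<le> \<bar>(\<Sum>i<n. of_int (q i) * \<alpha> i) - of_int p\<bar>"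
        unfolding xi powi[OF norm(1)[OF nz]] .
    qed simp
    then show "badly_approximable n \<alpha>"
      unfolding badly_approximable_def using c by auto
  qed
qed

text \<open>Dirichlet's box argument with a separate resolution for each coordinate. The
  \<open>(N + 1) ^ n\<close> points \<open>q\<close> of a cube are sorted by the cells containing
  \<open>q i / N\<close> and the fractional part of \<open>L q\<close>. By \<open>count\<close>
  there are fewer cells than points, and \<open>w\<close> comes from the difference of two points in
  one cell.\<close>

lemma pigeonhole_small_vector:
  fixes a :: "nat \<Rightarrow> real"
  assumes "N \<ge> 1" "\<epsilon> > 0" and a: "\<And>i. i \<le> n \<Longrightarrow> a i > 0"
    and count: "(\<Prod>i<n. a i + 1) * (a n / \<epsilon> + 1) < real (N + 1) ^ n"
  obtains w where "\<exists>i<n. w i \<noteq> 0" "\<And>j. j > n \<Longrightarrow> w j = 0"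
    and "\<And>i. i < n \<Longrightarrow> \<bar>real_of_int (w i)\<bar> * a i < N" "\<bar>xi n \<alpha> w\<bar> * a n < \<epsilon>"
proof -
  define L where "L q = (\<Sum>i<n. of_int (q i) * \<alpha> i)" for q :: "nat \<Rightarrow> int"
  define b where "b i = (if i < n then a i else a n / \<epsilon>)" for i
  define y where "y q i = (if i < n then of_int (q i) / N else frac (L q))" for q :: "nat \<Rightarrow> int" and i
  define g where "g q = (\<lambda>i\<in>{..n}. \<lfloor>b i * y q i\<rfloor>)" for q
  define Q where "Q = (\<Pi>\<^sub>E i\<in>{..<n}. {0..int N})"
  \<comment> \<open>Since \<open>q i / N\<close> can equal 1, the index
    \<open>\<lfloor>b i\<rfloor>\<close> is included; this gives
    \<open>\<lfloor>b i\<rfloor> + 1\<close> cells, at most \<open>b i + 1\<close>.\<close>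
  define B where "B = (\<Pi>\<^sub>E i\<in>{..n}. {0..\<lfloor>b i\<rfloor>})"
  have b: "b i > 0" if "i \<le> n" for i
    using a that assms(2) by (auto simp: b_def)
  have fin: "finite B" unfolding B_def by (intro finite_PiE) auto
  have image: "g ` Q \<subseteq> B"
  proof (rule image_subsetI)
    fix q assume q: "q \<in> Q"
    have y: "0 \<le> y q i \<and> y q i \<le> 1" if "i \<le> n" for i
    proof (cases "i < n")
      case True
      then have "q i \<in> {0..int N}" using PiE_mem[OF q[unfolded Q_def]] by simp
      then have "0 \<le> real_of_int (q i)" "real_of_int (q i) \<le> real N" by simp_all
      then show ?thesis using True assms(1) by (simp add: y_def divide_le_eq_1)
    next
      case False
      then show ?thesis using frac_lt_1[of "L q"] by (simp add: y_def)
    qed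
    have "\<lfloor>b i * y q i\<rfloor> \<in> {0..\<lfloor>b i\<rfloor>}" if "i \<le> n" for i
    proof -
      have "0 \<le> b i * y q i" "b i * y q i \<le> b i"
        using b[OF that] y[OF that] by (simp_all add: mult_left_le)
      then show ?thesis by (auto intro: floor_mono)
    qed
    then show "g q \<in> B" by (auto simp: g_def B_def)
  qed
  have less: "card B < card Q"
  proof -
    have "real (card B) = (\<Prod>i\<le>n. real (card {0..\<lfloor>b i\<rfloor>}))"
      unfolding B_def by (simp add: card_PiE)
    also have "\<dots> \<le> (\<Prod>i\<le>n. b i + 1)"
    proof (intro prod_mono conjI)
      fix i assume "i \<in> {..n}"
      then have "b i > 0" using b by simp
      then have "0 \<le> \<lfloor>b i\<rfloor>" by simp
      then have "real (card {0..\<lfloor>b i\<rfloor>}) = of_int \<lfloor>b i\<rfloor> + 1" by simp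
      then show "real (card {0..\<lfloor>b i\<rfloor>}) \<le> b i + 1" by linarith
    qed simp
    also have "\<dots> = (\<Prod>i<n. a i + 1) * (a n / \<epsilon> + 1)"
      by (simp add: lessThan_Suc_atMost[symmetric] b_def)
    also have "\<dots> < real (N + 1) ^ n" by (rule count)
    also have "\<dots> = real (card Q)"
      unfolding Q_def by (simp add: card_PiE nat_add_distrib)
    finally show ?thesis by simp
  qed
  have "\<not> inj_on g Q"
    using card_inj_on_le[OF _ image fin] less by linarith
  then obtain q q' where q: "q \<in> Q" "q' \<in> Q" "q \<noteq> q'" "g q = g q'"
    unfolding inj_on_def by blast
  have close: "b i * \<bar>y q i - y q' i\<bar> < 1" if "i \<le> n" for i
  proof -
    have "\<lfloor>b i * y q i\<rfloor> = \<lfloor>b i * y q' i\<rfloor>"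
      using fun_cong[OF q(4), of i] that by (simp add: g_def)
    then have "\<bar>b i * y q i - b i * y q' i\<bar> < 1"
      using floor_correct[of "b i * y q i"] floor_correct[of "b i * y q' i"] by linarith
    moreover have "\<bar>b i * y q i - b i * y q' i\<bar> = b i * \<bar>y q i - y q' i\<bar>"
      unfolding right_diff_distrib[symmetric] abs_mult using b[OF that] by simp
    ultimately show ?thesis by simp
  qed
  \<comment> \<open>The last coordinate is a difference of integer parts, chosen so that
    \<open>xi\<close> becomes a difference of fractional parts.\<close>
  define w where "w i = (if i < n then q i - q' i else if i = n then \<lfloor>L q'\<rfloor> - \<lfloor>L q\<rfloor> else 0)" for i
  have xi: "xi n \<alpha> w = frac (L q) - frac (L q')"
    by (simp add: xi_def w_def L_def frac_def sum_subtractf algebra_simps)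
  show ?thesis
  proof (rule that[of w])
    show "\<exists>i<n. w i \<noteq> 0"
      using q PiE_ext[of q "{..<n}" "\<lambda>_. {0..int N}" q'] by (auto simp: Q_def w_def)
    show "w j = 0" if "j > n" for j using that by (simp add: w_def)
    show "\<bar>real_of_int (w i)\<bar> * a i < N" if "i < n" for i
    proof -
      have "a i * \<bar>(of_int (q i) - of_int (q' i)) / real N\<bar> < 1"
        using close[of i] that by (simp add: b_def y_def diff_divide_distrib)
      then have "\<bar>of_int (q i) - of_int (q' i)\<bar> * a i / real N < 1"
        by (simp add: abs_divide mult.commute)
      then show ?thesis
        using that assms(1) by (simp add: w_def pos_divide_less_eq)
    qed
    have "\<bar>frac (L q) - frac (L q')\<bar> * a n / \<epsilon> < 1"
      using close[of n] by (simp add: b_def y_def mult.commute)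
    then show "\<bar>xi n \<alpha> w\<bar> * a n < \<epsilon>"
      using assms(2) by (simp add: xi pos_divide_less_eq)
  qed
qed

text \<open>The idea: measure an integer vector by the coordinates \<open>w i / N\<close> and \<open>xi w / \<epsilon>\<close>. On a
  hyperplane, the coordinate with the largest coefficient is controlled by the other ones. Hence
  a coarse pigeonhole grid in that coordinate and a fine one in the others would yield a vector
  contradicting bad approximability if all vectors of the box were on the hyperplane.\<close>

lemma exists_small_vector_off_hyperplane:
  assumes n: "n \<ge> 1" and c: "c > 0"
    and bad: "\<And>w s. \<exists>i<n. w i \<noteq> 0 \<Longrightarrow> \<forall>i<n. \<bar>real_of_int (w i)\<bar> \<le> s \<Longrightarrow> c \<le> s ^ n * \<bar>xi n \<alpha> w\<bar>"
  obtains K :: real where "K \<ge> 1"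
    and "\<And>N v. N \<ge> 1 \<Longrightarrow> \<exists>i\<le>n. v i \<noteq> 0 \<Longrightarrow>
      \<exists>w. (\<forall>j>n. w j = 0) \<and> (\<forall>j\<le>n. \<bar>real_of_int (w j)\<bar> \<le> K * real N) \<and>
          \<bar>xi n \<alpha> w\<bar> * real N ^ n \<le> K \<and> (\<Sum>i\<le>n. v i * of_int (w i)) \<noteq> (0 :: real)"
proof -
  define D where "D = (\<Sum>i<n. \<bar>\<alpha> i\<bar>) + 1"
  \<comment> \<open>\<open>M\<close> makes \<open>c * M\<close> at least
    \<open>2 * (n + 1) ^ n\<close>, as the cell count requires. \<open>T\<close> is set so that,
    when \<open>\<epsilon> * N ^ n = T\<close>, a vector with all scaled coordinates below
    \<open>1 / M\<close> violates \<open>bad\<close>.\<close>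
  define M where "M = nat \<lceil>2 * real (n + 1) ^ n / c\<rceil>"
  define T where "T = c * real M ^ (n + 1)"
  define K where "K = D * (1 + T)"
  have D: "D \<ge> 1" unfolding D_def by (simp add: sum_nonneg)
  have "2 * real (n + 1) ^ n / c > 0" using c by simp
  then have M: "M \<ge> 1" and "2 * real (n + 1) ^ n / c \<le> real M" unfolding M_def by linarith+
  then have cM: "2 * real (n + 1) ^ n \<le> c * real M" using c by (simp add: field_simps)
  have T: "T > 0" unfolding T_def using c M by simp
  have "1 * 1 \<le> D * (1 + T)" using D T by (intro mult_mono) auto
  then have K: "K \<ge> 1" by (simp add: K_def)
  have "T \<le> D * T" "K = D + D * T" using D T by (simp_all add: K_def algebra_simps)
  then have DK: "D \<le> K" "D * T \<le> K" "T \<le> K" using D T by linarith+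
  show ?thesis
  proof (rule that[OF K])
    fix N :: nat and v :: "nat \<Rightarrow> real"
    assume N: "N \<ge> 1" and v: "\<exists>i\<le>n. v i \<noteq> 0"
    have N1: "real N \<ge> 1" using N by simp
    show "\<exists>w. (\<forall>j>n. w j = 0) \<and> (\<forall>j\<le>n. \<bar>real_of_int (w j)\<bar> \<le> K * real N) \<and>
          \<bar>xi n \<alpha> w\<bar> * real N ^ n \<le> K \<and> (\<Sum>i\<le>n. v i * of_int (w i)) \<noteq> 0"
    proof (cases "real N ^ n \<le> T")
      \<comment> \<open>For \<open>N ^ n \<le> T\<close> a bounded \<open>xi\<close> is small
        enough, so a unit vector off the hyperplane suffices.\<close>
      case True
      obtain j where j: "j \<le> n" "v j \<noteq> 0" using v by blast
      define e :: "nat \<Rightarrow> int" where "e i = (if i = j then 1 else 0)" for i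
      have "(\<Sum>i\<le>n. v i * of_int (e i)) = (\<Sum>i\<le>n. if i = j then v i else 0)"
        by (rule sum.cong) (auto simp: e_def)
      then have "(\<Sum>i\<le>n. v i * of_int (e i)) \<noteq> 0" using j by simp
      moreover have "\<bar>xi n \<alpha> e\<bar> * real N ^ n \<le> K"
      proof -
        have "\<bar>xi n \<alpha> e\<bar> \<le> D"
          using xi_bound[of n e 1 \<alpha>] by (simp add: e_def D_def)
        then have "\<bar>xi n \<alpha> e\<bar> * real N ^ n \<le> D * T"
          using True D by (intro mult_mono) auto
        then show ?thesis using DK by linarith
      qed
      moreover have "\<bar>real_of_int (e i)\<bar> \<le> K * real N" for i
        using mult_mono[of 1 K 1 "real N"] K N1 by (auto simp: e_def)
      ultimately show ?thesis
        using j by (intro exI[of _ e]) (auto simp: e_def)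
    next
      case False
      define \<epsilon> where "\<epsilon> = T / real N ^ n"
      have Nn: "real N ^ n > 0" using N by simp
      have eps: "0 < \<epsilon>" "\<epsilon> \<le> 1" "\<epsilon> * real N ^ n = T"
        using False T Nn by (simp_all add: \<epsilon>_def)
      \<comment> \<open>\<open>u\<close> expresses the linear form given by \<open>v\<close> in the
        scaled coordinates \<open>x\<close>, after \<open>w n\<close> has been eliminated through
        \<open>xi\<close>.\<close>
      define u where "u i = (if i < n then (v i - v n * \<alpha> i) * real N else v n * \<epsilon>)" for i
      define x where "x w i = (if i < n then of_int (w i) / real N else xi n \<alpha> w / \<epsilon>)"
        for w :: "nat \<Rightarrow> int" and i
      have ux: "(\<Sum>i\<le>n. v i * of_int (w i)) = (\<Sum>i\<le>n. u i * x w i)" for w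
      proof -
        have "(\<Sum>i\<le>n. u i * x w i) = (\<Sum>i<n. (v i - v n * \<alpha> i) * of_int (w i)) + v n * xi n \<alpha> w"
          using eps(1) N by (simp add: lessThan_Suc_atMost[symmetric] u_def x_def)
        also have "\<dots> = (\<Sum>i<n. v i * of_int (w i)) + v n * of_int (w n)"
          by (simp add: xi_def algebra_simps sum_subtractf sum_distrib_left)
        finally show ?thesis by (simp add: lessThan_Suc_atMost[symmetric])
      qed
      obtain j where j: "j \<le> n" "\<And>i. i \<le> n \<Longrightarrow> \<bar>u i\<bar> \<le> \<bar>u j\<bar>"
        using ex_is_arg_min_if_finite[of "{..n}" "\<lambda>i. - \<bar>u i\<bar>"] by (auto simp: is_arg_min_linorder)
      have uj: "\<bar>u j\<bar> > 0"
      proof (rule ccontr)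
        assume "\<not> \<bar>u j\<bar> > 0"
        then have u0: "u i = 0" if "i \<le> n" for i using j(2)[OF that] by simp
        then have "v n = 0" using eps(1) u0[of n] by (simp add: u_def)
        then have "v i = 0" if "i \<le> n" for i
          using u0[OF that] N that by (cases "i = n") (simp_all add: u_def)
        then show False using v by blast
      qed
      \<comment> \<open>Resolution 1 in the dominant coordinate \<open>j\<close> and
        \<open>n * M\<close> in the \<open>n\<close> others, so that the \<open>n\<close> other
        terms, each below \<open>1 / (n * M)\<close>, sum to less than \<open>1 / M\<close>.\<close>
      define a where "a i = (if i = j then 1 else real (n * M))" for i
      have nM: "n * M \<ge> 1" using n M by simp
      have nM1: "real (n * M) \<ge> 1" using nM by linarith
      have a1: "a i \<ge> 1" for i using nM1 by (simp add: a_def)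
      have count: "(\<Prod>i<n. a i + 1) * (a n / \<epsilon> + 1) < real (N + 1) ^ n"
      proof -
        have "(\<Prod>i\<le>n. a i + 1) = 2 * real (n * M + 1) ^ n"
        proof -
          have "(\<Prod>i\<le>n. a i + 1) = (a j + 1) * (\<Prod>i\<in>{..n} - {j}. a i + 1)"
            using j(1) by (intro prod.remove) auto
          also have "(\<Prod>i\<in>{..n} - {j}. a i + 1) = (\<Prod>i\<in>{..n} - {j}. real (n * M + 1))"
            by (rule prod.cong) (auto simp: a_def)
          finally show ?thesis using j(1) by (simp add: a_def)
        qed
        then have total: "(\<Prod>i<n. a i + 1) * (a n + 1) = 2 * real (n * M + 1) ^ n"
          by (simp add: lessThan_Suc_atMost[symmetric])
        \<comment> \<open>As \<open>\<epsilon> \<le> 1\<close>, the summand 1 is at most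
          \<open>1 / \<epsilon>\<close>, so \<open>1 / \<epsilon>\<close> factors out; the choice of
          \<open>M\<close> then absorbs \<open>2 * (n + 1) ^ n\<close>.\<close>
        have "(\<Prod>i<n. a i + 1) * (a n / \<epsilon> + 1) \<le> (\<Prod>i<n. a i + 1) * ((a n + 1) / \<epsilon>)"
          using eps a1 by (intro mult_left_mono prod_nonneg)
            (auto simp: add_divide_distrib intro: add_nonneg_nonneg order.trans[OF zero_le_one])
        also have "\<dots> = 2 * real (n * M + 1) ^ n / \<epsilon>" using total by simp
        also have "\<dots> \<le> 2 * (real (n + 1) * real M) ^ n / \<epsilon>"
          using eps(1) M by (intro divide_right_mono mult_left_mono power_mono) (auto simp: algebra_simps)
        also have "\<dots> = 2 * real (n + 1) ^ n * real M ^ n / \<epsilon>" by (simp only: power_mult_distrib mult.assoc)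
        also have "\<dots> \<le> (c * real M) * real M ^ n / \<epsilon>"
          using eps(1) cM by (intro divide_right_mono mult_right_mono) auto
        also have "\<dots> = T / \<epsilon>" by (simp add: T_def)
        also have "\<dots> = real N ^ n" using eps by (simp add: field_simps)
        also have "\<dots> < real (N + 1) ^ n" using n by (intro power_strict_mono) auto
        finally show ?thesis .
      qed
      have a0: "a i > 0" for i using a1[of i] by linarith
      obtain w where w: "\<exists>i<n. w i \<noteq> 0" "\<And>j. j > n \<Longrightarrow> w j = 0"
        "\<And>i. i < n \<Longrightarrow> \<bar>real_of_int (w i)\<bar> * a i < N" "\<bar>xi n \<alpha> w\<bar> * a n < \<epsilon>"
        by (rule pigeonhole_small_vector[OF N eps(1) a0 count, of \<alpha>]) blast
      have xa: "\<bar>x w i\<bar> * a i < 1" if "i \<le> n" for i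
        using w(3)[of i] w(4) that eps(1) N
        by (cases "i < n") (auto simp: x_def abs_divide pos_divide_less_eq)
      have x1: "\<bar>x w i\<bar> < 1" if "i \<le> n" for i
        using xa[OF that] mult_left_mono[OF a1, of "\<bar>x w i\<bar>" i] by simp
      have off: "(\<Sum>i\<le>n. v i * of_int (w i)) \<noteq> 0"
      proof
        assume "(\<Sum>i\<le>n. v i * of_int (w i)) = 0"
        \<comment> \<open>On the hyperplane, coordinate \<open>j\<close> is a combination of the
          others with coefficients of absolute value at most 1. So it is below \<open>1 / M\<close>
          too, although its grid was coarse.\<close>
        then have "u j * x w j + (\<Sum>i\<in>{..n} - {j}. u i * x w i) = 0"
          using j(1) unfolding ux by (subst (asm) sum.remove[of _ j]) auto
        then have "\<bar>u j\<bar> * \<bar>x w j\<bar> = \<bar>\<Sum>i\<in>{..n} - {j}. u i * x w i\<bar>"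
          by (simp add: abs_mult[symmetric] add_eq_0_iff)
        also have "\<dots> \<le> (\<Sum>i\<in>{..n} - {j}. \<bar>u j\<bar> * \<bar>x w i\<bar>)"
          using j(2) by (intro order.trans[OF sum_abs] sum_mono) (auto simp: abs_mult intro!: mult_right_mono)
        also have "\<dots> = \<bar>u j\<bar> * (\<Sum>i\<in>{..n} - {j}. \<bar>x w i\<bar>)" by (simp add: sum_distrib_left)
        finally have "\<bar>x w j\<bar> \<le> (\<Sum>i\<in>{..n} - {j}. \<bar>x w i\<bar>)" using uj by simp
        also have "\<dots> < of_nat (card ({..n} - {j})) * (1 / real (n * M))"
        proof (rule sum_bounded_above_strict)
          show "\<bar>x w i\<bar> < 1 / real (n * M)" if "i \<in> {..n} - {j}" for i
            using xa[of i] that nM1 by (simp add: a_def field_simps)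
          show "card ({..n} - {j}) > 0" using j(1) n by simp
        qed
        also have "\<dots> = 1 / real M" using j(1) n by simp
        finally have xj: "\<bar>x w j\<bar> < 1 / real M" .
        have x: "\<bar>x w i\<bar> < 1 / real M" if "i \<le> n" for i
        proof (cases "i = j")
          case False
          then have "\<bar>x w i\<bar> < 1 / real (n * M)"
            using xa[OF that] nM1 by (simp add: a_def field_simps)
          also have "\<dots> \<le> 1 / real M" using n M by (simp add: field_simps)
          finally show ?thesis .
        qed (use xj in simp)
        \<comment> \<open>Now all scaled coordinates are below \<open>1 / M\<close>. The definition
          of \<open>T\<close> makes the resulting strict upper bound exactly
          \<open>c\<close>.\<close>
        have "c \<le> (real N / real M) ^ n * \<bar>xi n \<alpha> w\<bar>"
        proof (rule bad[OF w(1)], intro allI impI)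
          fix i assume "i < n"
          then show "\<bar>real_of_int (w i)\<bar> \<le> real N / real M"
            using x[of i] N M by (simp add: x_def abs_divide field_simps)
        qed
        also have "\<dots> < (real N / real M) ^ n * (\<epsilon> / real M)"
          using x[of n] eps(1) N M
          by (intro mult_strict_left_mono) (auto simp: x_def abs_divide field_simps)
        also have "\<dots> = (\<epsilon> * real N ^ n) / real M ^ (n + 1)"
          by (simp add: power_divide field_simps)
        also have "\<dots> = c" unfolding eps(3) T_def using M by simp
        finally show False by simp
      qed
      have xi_eps: "\<bar>xi n \<alpha> w\<bar> < \<epsilon>" using x1[of n] eps(1) by (simp add: x_def abs_divide)
      have wN: "\<bar>real_of_int (w i)\<bar> \<le> real N" if "i < n" for i
        using x1[of i] that N by (simp add: x_def abs_divide)
      have "\<bar>real_of_int (w i)\<bar> \<le> D * real N" if "i \<le> n" for i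
      proof (cases "i < n")
        case True
        then show ?thesis using wN[of i] mult_right_mono[OF D, of "real N"] by simp
      next
        case False
        then have "i = n" using that by simp
        \<comment> \<open>The grid does not see \<open>w n\<close> itself; it is recovered as
          \<open>xi\<close> minus this sum, with the absolute value of \<open>xi\<close> below
          \<open>\<epsilon> \<le> 1\<close>.\<close>
        have "\<bar>\<Sum>i<n. of_int (w i) * \<alpha> i\<bar> \<le> (\<Sum>i<n. real N * \<bar>\<alpha> i\<bar>)"
          using wN by (intro order.trans[OF sum_abs] sum_mono) (auto simp: abs_mult intro!: mult_right_mono)
        then have "\<bar>real_of_int (w n)\<bar> \<le> real N * (\<Sum>i<n. \<bar>\<alpha> i\<bar>) + 1"
          using xi_eps eps(2) unfolding xi_def sum_distrib_left by linarith
        then show ?thesis using N1 \<open>i = n\<close> by (simp add: D_def algebra_simps)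
      qed
      then have "\<bar>real_of_int (w i)\<bar> \<le> K * real N" if "i \<le> n" for i
        using that DK(1) mult_right_mono[of D K "real N"] by fastforce
      moreover have "\<bar>xi n \<alpha> w\<bar> * real N ^ n \<le> K"
        using mult_right_mono[OF less_imp_le[OF xi_eps], of "real N ^ n"] eps(3) DK(3) by simp
      ultimately show ?thesis using w(2) off by blast
    qed
  qed
qed

text \<open>The first \<open>n\<close> rows lie in a hyperplane, and a small vector off this
  hyperplane competes in the choice of the last row.\<close>

lemma xi_last_row_bounded:
  assumes n: "n \<ge> 1" and indep: "lin_indep_with_one n \<alpha>" and c: "c > 0"
    and bad: "\<And>w s. \<exists>i<n. w i \<noteq> 0 \<Longrightarrow> \<forall>i<n. \<bar>real_of_int (w i)\<bar> \<le> s \<Longrightarrow> c \<le> s ^ n * \<bar>xi n \<alpha> w\<bar>"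
  obtains C :: real where "C > 0"
    and "\<And>m. m \<ge> 1 \<Longrightarrow> real m ^ n * \<bar>xi n \<alpha> (mink_A n \<alpha> m ! n)\<bar> \<le> C"
proof -
  obtain K :: real where K: "K \<ge> 1" and small: "\<And>N v. N \<ge> 1 \<Longrightarrow> \<exists>i\<le>n. v i \<noteq> 0 \<Longrightarrow>
      \<exists>w. (\<forall>j>n. w j = 0) \<and> (\<forall>j\<le>n. \<bar>real_of_int (w j)\<bar> \<le> K * real N) \<and>
          \<bar>xi n \<alpha> w\<bar> * real N ^ n \<le> K \<and> (\<Sum>i\<le>n. v i * of_int (w i)) \<noteq> (0 :: real)"
    using exists_small_vector_off_hyperplane[OF n c bad] by blast
  define k where "k = nat \<lceil>K\<rceil>"
  have k: "k \<ge> 1" "K \<le> real k" unfolding k_def using K by linarith+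
  define D where "D = (\<Sum>i<n. \<bar>\<alpha> i\<bar>) + 1"
  have D: "D \<ge> 1" unfolding D_def by (simp add: sum_nonneg)
  \<comment> \<open>One summand for each case below: \<open>m < k\<close>, where the crude bound of
    \<open>xi\<close> on the box is enough, and \<open>m \<ge> k\<close>.\<close>
  define C where "C = real k ^ n * (real k * D) + (2 * real k) ^ n * K"
  have pos: "real k ^ n * (real k * D) > 0" "(2 * real k) ^ n * K > 0" using k D K by auto
  show ?thesis
  proof (rule that[of C])
    show "C > 0" unfolding C_def using pos by linarith
    fix m :: nat assume m: "m \<ge> 1"
    interpret minkowski_matrix n \<alpha> m by unfold_locales (fact indep m)+
    let ?\<beta> = "\<bar>xi n \<alpha> (mink_A n \<alpha> m ! n)\<bar>"
    show "real m ^ n * ?\<beta> \<le> C"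
    proof (cases "m < k")
      case True
      have "?\<beta> \<le> real m * D"
        unfolding D_def
      proof (rule xi_bound)
        fix j assume "j \<le> n"
        then show "\<bar>real_of_int ((mink_A n \<alpha> m ! n) j)\<bar> \<le> real m"
          using row_bound[of n j] by linarith
      qed
      also have "\<dots> \<le> real k * D" using True D by (intro mult_right_mono) auto
      finally have "real m ^ n * ?\<beta> \<le> real k ^ n * (real k * D)"
        using True by (intro mult_mono power_mono) auto
      then show ?thesis unfolding C_def using pos by linarith
    next
      case False
      \<comment> \<open>The largest \<open>N\<close> with \<open>k * N \<le> m\<close>: vectors of
        size \<open>K * N\<close> fit into the box of size \<open>m\<close>, and
        \<open>m < 2 * k * N\<close> costs only a constant.\<close>
      define N where "N = m div k"
      have N: "N \<ge> 1" using False k by (simp add: N_def div_greater_zero_iff Suc_le_eq)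
      have kN: "k * N \<le> m" by (simp add: N_def)
      have "m mod k < k" using k by simp
      then have "m < k * N + k" unfolding N_def using mult_div_mod_eq[of k m] by linarith
      also have "\<dots> \<le> 2 * k * N" using mult_le_mono2[OF N, of k] by linarith
      finally have m2: "real m \<le> 2 * real k * real N"
        by (metis less_imp_le of_nat_le_iff of_nat_mult of_nat_numeral)
      obtain v :: "nat \<Rightarrow> real" where v: "\<exists>i\<le>n. v i \<noteq> 0"
        and o: "\<And>w. rat_span n (mink_rows n \<alpha> m n) w \<Longrightarrow> (\<Sum>i\<le>n. v i * of_int (w i)) = 0"
        using exists_orthogonal_to_span[of "mink_rows n \<alpha> m n" n] by auto
      obtain w where w: "\<forall>j>n. w j = 0" "\<forall>j\<le>n. \<bar>real_of_int (w j)\<bar> \<le> K * real N"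
        "\<bar>xi n \<alpha> w\<bar> * real N ^ n \<le> K" "(\<Sum>i\<le>n. v i * of_int (w i)) \<noteq> 0"
        using small[OF N v] by blast
      have wm: "\<bar>w j\<bar> \<le> int m" if "j \<le> n" for j
      proof -
        have "\<bar>real_of_int (w j)\<bar> \<le> K * real N" using w(2) that by blast
        also have "\<dots> \<le> real k * real N" using k by (intro mult_right_mono) auto
        also have "\<dots> \<le> real m" using kN by (metis of_nat_le_iff of_nat_mult)
        finally show ?thesis by linarith
      qed
      have "?\<beta> \<le> \<bar>xi n \<alpha> w\<bar>"
        using w(1,4) wm o by (intro xi_row_le) auto
      then have "real m ^ n * ?\<beta> \<le> (2 * real k * real N) ^ n * \<bar>xi n \<alpha> w\<bar>"
        using m2 by (intro mult_mono power_mono) auto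
      also have "\<dots> = (2 * real k) ^ n * (\<bar>xi n \<alpha> w\<bar> * real N ^ n)"
        by (simp only: power_mult_distrib mult_ac)
      also have "\<dots> \<le> (2 * real k) ^ n * K"
        using w(3) by (intro mult_left_mono) auto
      finally show ?thesis unfolding C_def using pos by linarith
    qed
  qed
qed

section \<open>Distinct matrices of the chain\<close>

lemma mink_A_representative:
  assumes "m \<ge> 1"
  obtains j where "j \<in> mink_new_indices n \<alpha>" "mink_A n \<alpha> j = mink_A n \<alpha> m"
proof -
  define j where "j = (LEAST j. j \<ge> 1 \<and> mink_A n \<alpha> j = mink_A n \<alpha> m)"
  have j: "j \<ge> 1 \<and> mink_A n \<alpha> j = mink_A n \<alpha> m"
    unfolding j_def by (rule LeastI[of _ m]) (use assms in simp)
  moreover have "\<not> (i \<ge> 1 \<and> mink_A n \<alpha> i = mink_A n \<alpha> m)" if "i < j" for i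
    using not_less_Least that unfolding j_def by blast
  ultimately have "j \<in> mink_new_indices n \<alpha>"
    unfolding mink_new_indices_def by auto
  then show ?thesis using that j by blast
qed

text \<open>The enumeration reaches every first occurrence, be the set of new indices finite or
  infinite; \<open>Suc i\<close> undoes the shift \<open>k - 1\<close> in
  \<open>mink_chain\<close>.\<close>

lemma mink_A_in_chain:
  assumes "m \<ge> 1"
  obtains k where "k \<ge> 1" "mink_chain n \<alpha> k = mink_A n \<alpha> m"
proof -
  let ?S = "mink_new_indices n \<alpha>"
  obtain j where j: "j \<in> ?S" "mink_A n \<alpha> j = mink_A n \<alpha> m"
    using mink_A_representative[OF assms] by blast
  obtain i where "enumerate ?S i = j"
    using enumerate_Ex[OF _ j(1)] finite_enumerate_Ex[OF _ j(1)] by blast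
  then show ?thesis
    using that[of "Suc i"] j(2) by (simp add: mink_chain_def)
qed

text \<open>Beyond the size of a finite set \<open>enumerate\<close> need not return members, so a
  claim about all \<open>k \<ge> 1\<close> has to know that the chain does not stop. With finitely
  many matrices the last values would have a positive minimum, whereas \<open>C\<close> forces them
  to tend to 0.\<close>

lemma infinite_mink_new_indices:
  assumes n: "n \<ge> 1" and indep: "lin_indep_with_one n \<alpha>"
    and C: "\<And>m. m \<ge> 1 \<Longrightarrow> real m ^ n * \<bar>xi n \<alpha> (mink_A n \<alpha> m ! n)\<bar> \<le> C"
  shows "infinite (mink_new_indices n \<alpha>)"
proof
  let ?S = "mink_new_indices n \<alpha>"
  let ?\<beta> = "\<lambda>m. \<bar>xi n \<alpha> (mink_A n \<alpha> m ! n)\<bar>"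
  assume fin: "finite ?S"
  have pos: "?\<beta> m > 0" if "m \<ge> 1" for m
  proof -
    interpret minkowski_matrix n \<alpha> m by unfold_locales (fact indep that)+
    show ?thesis using xi_row_nonzero[of n] by simp
  qed
  define \<mu> where "\<mu> = Min (?\<beta> ` ?S)"
  have "?S \<noteq> {}" using mink_A_representative[of 1 n \<alpha>] by auto
  then have "\<mu> \<in> ?\<beta> ` ?S" unfolding \<mu>_def using fin by (intro Min_in) auto
  then have \<mu>: "\<mu> > 0" using pos by (auto simp: mink_new_indices_def)
  obtain m :: nat where m: "real m > C / \<mu>" "m \<ge> 1"
  proof -
    obtain i :: nat where "C / \<mu> < real i" using reals_Archimedean2 by blast
    then show ?thesis using that[of "Suc i"] by simp
  qed
  obtain j where "j \<in> ?S" "mink_A n \<alpha> j = mink_A n \<alpha> m" using mink_A_representative[OF m(2)] by blast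
  then have "\<mu> \<le> ?\<beta> m" unfolding \<mu>_def using fin by (metis Min_le finite_imageI imageI)
  have "C < real m * \<mu>" using m(1) \<mu> by (simp add: pos_divide_less_eq)
  also have "\<dots> \<le> real m ^ n * ?\<beta> m"
    using n m(2) \<open>\<mu> \<le> ?\<beta> m\<close> \<mu> by (intro mult_mono) (auto intro: self_le_power)
  finally show False using C[OF m(2)] by linarith
qed

section \<open>Comparison of the first and last values along the chain\<close>

theorem theorem3:
  fixes n :: nat and \<alpha> :: "nat \<Rightarrow> real"
  assumes "n \<ge> 1"
    and "lin_indep_with_one n \<alpha>"
  shows "badly_approximable n \<alpha> \<longleftrightarrow>
         (\<exists>\<delta>>0. \<forall>k\<ge>1. \<bar>chain_alpha n \<alpha> k 1\<bar> \<ge> \<delta>)"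
proof
  assume "badly_approximable n \<alpha>"
  then obtain c where c: "c > 0" and bad: "\<And>w s. \<exists>i<n. w i \<noteq> 0 \<Longrightarrow>
      \<forall>i<n. \<bar>real_of_int (w i)\<bar> \<le> s \<Longrightarrow> c \<le> s ^ n * \<bar>xi n \<alpha> w\<bar>"
    unfolding badly_approximable_iff by blast
  obtain C :: real where C: "C > 0"
    and last: "\<And>m. m \<ge> 1 \<Longrightarrow> real m ^ n * \<bar>xi n \<alpha> (mink_A n \<alpha> m ! n)\<bar> \<le> C"
    using xi_last_row_bounded[OF assms c bad] by blast
  have inf: "infinite (mink_new_indices n \<alpha>)"
    using infinite_mink_new_indices[OF assms last] .
  \<comment> \<open>The 1 covers a first row whose only nonzero entry is the last:
    \<open>bad\<close> does not apply to it, but its \<open>xi\<close> is a nonzero integer.\<close>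
  have "min c 1 / C \<le> \<bar>chain_alpha n \<alpha> k 1\<bar>" if "k \<ge> 1" for k
  proof -
    define m where "m = enumerate (mink_new_indices n \<alpha>) (k - 1)"
    have m: "m \<ge> 1"
      using enumerate_in_set[OF inf, of "k - 1"] by (simp add: m_def mink_new_indices_def)
    interpret minkowski_matrix n \<alpha> m by unfold_locales (fact assms(2) m)+
    let ?w = "mink_A n \<alpha> m ! 0" and ?\<beta> = "\<bar>xi n \<alpha> (mink_A n \<alpha> m ! n)\<bar>"
    have first: "min c 1 \<le> real m ^ n * \<bar>xi n \<alpha> ?w\<bar>"
    proof (cases "\<exists>i<n. ?w i \<noteq> 0")
      case True
      have "\<bar>real_of_int (?w i)\<bar> \<le> real m" if "i < n" for i
        using row_bound[of 0 i] that by linarith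
      then show ?thesis using bad[OF True, of "real m"] by simp
    next
      case False
      then have "?w n \<noteq> 0" using row_nonzero[of 0] by (auto simp: le_less)
      then have "\<bar>?w n\<bar> \<ge> 1" by linarith
      then have "\<bar>xi n \<alpha> ?w\<bar> \<ge> 1" using False by (simp add: xi_def)
      then have "1 * 1 \<le> real m ^ n * \<bar>xi n \<alpha> ?w\<bar>" using m by (intro mult_mono) auto
      then show ?thesis by simp
    qed
    have \<beta>: "?\<beta> > 0" using xi_row_nonzero[of n] by simp
    have mn: "real m ^ n > 0" using m by simp
    have "min c 1 / C \<le> (real m ^ n * \<bar>xi n \<alpha> ?w\<bar>) / (real m ^ n * ?\<beta>)"
      using first last[OF m] c \<beta> mn by (intro frac_le) auto
    also have "\<dots> = \<bar>xi n \<alpha> ?w\<bar> / ?\<beta>" using m by simp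
    also have "\<dots> = \<bar>chain_alpha n \<alpha> k 1\<bar>"
      by (simp add: chain_alpha_def chain_beta_def mink_chain_def m_def)
    finally show ?thesis .
  qed
  then show "\<exists>\<delta>>0. \<forall>k\<ge>1. \<bar>chain_alpha n \<alpha> k 1\<bar> \<ge> \<delta>"
    using c C by (intro exI[of _ "min c 1 / C"]) simp
next
  assume "\<exists>\<delta>>0. \<forall>k\<ge>1. \<bar>chain_alpha n \<alpha> k 1\<bar> \<ge> \<delta>"
  then obtain \<delta> where \<delta>: "\<delta> > 0" "\<And>k. k \<ge> 1 \<Longrightarrow> \<bar>chain_alpha n \<alpha> k 1\<bar> \<ge> \<delta>" by blast
  define D where "D = (\<Sum>i<n. \<bar>\<alpha> i\<bar>) + 1"
  have D: "D \<ge> 1" unfolding D_def by (simp add: sum_nonneg)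
  \<comment> \<open>Collects the factor \<open>fact (Suc n)\<close> of the determinant bound and the
    loss from passing from \<open>s\<close> to an integer \<open>m \<le> 2 * D * s\<close>.\<close>
  define F where "F = fact (Suc n) * (2 * D) ^ n"
  have F: "F > 0" unfolding F_def using D by simp
  have "min 1 (\<delta> / F) \<le> s ^ n * \<bar>xi n \<alpha> w\<bar>"
    if nz: "\<exists>i<n. w i \<noteq> 0" and s: "\<forall>i<n. \<bar>real_of_int (w i)\<bar> \<le> s" for w s
  proof -
    obtain i where i: "i < n" "w i \<noteq> 0" using nz by blast
    then have "\<bar>real_of_int (w i)\<bar> \<ge> 1" by linarith
    then have s1: "s \<ge> 1" using s i(1) by force
    show ?thesis
    proof (cases "\<bar>xi n \<alpha> w\<bar> \<ge> 1")
      case True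
      have "1 * 1 \<le> s ^ n * \<bar>xi n \<alpha> w\<bar>" using s1 True by (intro mult_mono) auto
      then show ?thesis by simp
    next
      case False
      \<comment> \<open>Since \<open>xi\<close> is below 1 in absolute value, the last coordinate is
        at most \<open>D * s\<close>, so \<open>w\<close> lies in the box of size \<open>m\<close>.
        Rounding up at most doubles because \<open>D * s \<ge> 1\<close>.\<close>
      define m where "m = nat \<lceil>D * s\<rceil>"
      have "1 * 1 \<le> D * s" using D s1 by (intro mult_mono) auto
      then have m: "m \<ge> 1" "D * s \<le> real m" "real m \<le> 2 * D * s"
        unfolding m_def by linarith+
      interpret minkowski_matrix n \<alpha> m by unfold_locales (fact assms(2) m(1))+
      let ?\<beta> = "\<bar>xi n \<alpha> (mink_A n \<alpha> m ! n)\<bar>"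
      have wn: "\<bar>real_of_int (w n)\<bar> \<le> D * s"
      proof -
        have "\<bar>\<Sum>i<n. of_int (w i) * \<alpha> i\<bar> \<le> (\<Sum>i<n. s * \<bar>\<alpha> i\<bar>)"
          using s by (intro order.trans[OF sum_abs] sum_mono) (auto simp: abs_mult intro!: mult_right_mono)
        then have "\<bar>real_of_int (w n)\<bar> \<le> s * (\<Sum>i<n. \<bar>\<alpha> i\<bar>) + 1"
          using False unfolding xi_def sum_distrib_left by linarith
        then show ?thesis using s1 by (simp add: D_def algebra_simps)
      qed
      have wm: "\<bar>w j\<bar> \<le> int m" if "j \<le> n" for j
      proof -
        have "\<bar>real_of_int (w j)\<bar> \<le> D * s"
        proof (cases "j = n")
          case False
          then have "\<bar>real_of_int (w j)\<bar> \<le> s" using s that by simp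
          also have "\<dots> \<le> D * s" using mult_right_mono[OF D, of s] s1 by simp
          finally show ?thesis .
        qed (use wn in simp)
        then show ?thesis using m(2) by linarith
      qed
      \<comment> \<open>Candidates vanish beyond \<open>n\<close>, which \<open>w\<close> need not
        do; \<open>xi\<close> ignores those entries.\<close>
      define w' where "w' j = (if j \<le> n then w j else 0)" for j
      have "\<bar>xi n \<alpha> (mink_A n \<alpha> m ! 0)\<bar> \<le> \<bar>xi n \<alpha> w'\<bar>"
        using wm i by (intro xi_first_row_le) (auto simp: w'_def intro!: exI[of _ i])
      then have first: "\<bar>xi n \<alpha> (mink_A n \<alpha> m ! 0)\<bar> \<le> \<bar>xi n \<alpha> w\<bar>"
        by (simp add: xi_def w'_def)
      obtain k where k: "k \<ge> 1" "mink_chain n \<alpha> k = mink_A n \<alpha> m"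
        using mink_A_in_chain[OF m(1)] by blast
      have "?\<beta> > 0" using xi_row_nonzero[of n] by simp
      then have "\<delta> * ?\<beta> \<le> \<bar>xi n \<alpha> (mink_A n \<alpha> m ! 0)\<bar>"
        using \<delta>(2)[OF k(1)] k(2)
        by (simp add: chain_alpha_def chain_beta_def abs_divide pos_le_divide_eq)
      then have \<beta>: "\<delta> * ?\<beta> \<le> \<bar>xi n \<alpha> w\<bar>" using first by linarith
      \<comment> \<open>The determinant keeps \<open>m ^ n * ?\<beta>\<close> away from 0, and the
        ratio bound transfers this from the last row to \<open>w\<close>.\<close>
      have "\<delta> * 1 \<le> \<delta> * (fact (Suc n) * real m ^ n * ?\<beta>)"
        using \<delta>(1) xi_last_row_ge by (intro mult_left_mono) auto
      also have "\<dots> = fact (Suc n) * real m ^ n * (\<delta> * ?\<beta>)" by (simp only: mult_ac)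
      also have "\<dots> \<le> fact (Suc n) * (2 * D * s) ^ n * \<bar>xi n \<alpha> w\<bar>"
        using \<beta> m(3) \<delta>(1) by (intro mult_mono power_mono) auto
      also have "\<dots> = (s ^ n * \<bar>xi n \<alpha> w\<bar>) * F"
        unfolding F_def by (simp only: power_mult_distrib mult_ac)
      finally have "\<delta> / F \<le> s ^ n * \<bar>xi n \<alpha> w\<bar>" using F by (simp add: pos_divide_le_eq)
      then show ?thesis by simp
    qed
  qed
  then show "badly_approximable n \<alpha>"
    unfolding badly_approximable_iff using \<delta>(1) F by (intro exI[of _ "min 1 (\<delta> / F)"]) auto
qed

end
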